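(* Let $G$ be a connected graph. Geodesics between vertices are stable in $G$ if and only if there is a constant $k\in\mathbb{N}$ such that for every pair of vertices $a,b$ with $d(a,b)\ge 2k+2$, every geodesic $[ab]$ joining them and every vertex $v\in[ab]$ with $d(v,\{a,b\})>k$, the vertex $v$ is $ab$-$N_k$-obstructing.
   Context: Every edge of the connected graph $G$ has length $1$, interior points of edges are points of $G$, and $d$ is the induced shortest-path (length) metric on $G$, making $G$ a geodesic metric space. Geodesics between vertices are stable in $G$ if there is a constant $R\ge0$ such that, for any two vertices $a,b$ of $G$ and any geodesic $[ab]$, every geodesic $\sigma$ joining $a$ to $b$ satisfies $d_H(\sigma,[ab])\le R$, where $d_H$ is the Hausdorff distance. For a set $S$ in $G$, $N_r(S):=\{x\in G : d(x,S)\le r\}$. Given two vertices $a,b$ and $r\in\mathbb{N}$, a set $S$ of vertices is $ab$-$N_r$-obstructing if $\gamma\cap N_r(S)\ne\emptyset$ for every geodesic $\gamma$ joining $a$ and $b$; a vertex $v$ is $ab$-$N_r$-obstructing if $\{v\}$ is. *)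

theory Defs
  imports "HOL-Analysis.Analysis" "Graph_Theory.Graph_Theory"
begin

text \<open>
  A graph is an \<open>('a, 'b) pre_digraph\<close> \<open>G\<close> with \<open>wf_digraph G\<close>: each element of \<open>arcs G\<close> is one
  undirected edge, and the choice of its tail and head only fixes a parametrization of the edge by
  the unit interval, which is reversible. (So a simple undirected graph is given by one arc per
  edge, not by a pair of opposite arcs.) Infinite graphs, loops and multiple edges are allowed.
  Connectedness is \<open>Digraph_Component.connected\<close>, which ignores the orientation.
\<close>

text \<open>\<open>Interior e t\<close> is the point at distance \<open>t\<close> from the tail along the edge \<open>e\<close>, \<open>0 < t < 1\<close>.\<close>

datatype ('a, 'b) graph_point = Vertex 'a | Interior 'b real

definition realization :: "('a, 'b) pre_digraph \<Rightarrow> ('a, 'b) graph_point set" where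
  "realization G = Vertex ` verts G \<union> {Interior e t | e t. e \<in> arcs G \<and> 0 < t \<and> t < 1}"

text \<open>The characteristic map of an edge, for \<open>0 \<le> t \<le> 1\<close>.\<close>

definition edge_point :: "('a, 'b) pre_digraph \<Rightarrow> 'b \<Rightarrow> real \<Rightarrow> ('a, 'b) graph_point" where
  "edge_point G e t =
     (if t = 0 then Vertex (tail G e) else if t = 1 then Vertex (head G e) else Interior e t)"

text \<open>
  \<open>pl_path G x l y\<close>: some piecewise linear path from \<open>x\<close> to \<open>y\<close>, i.e. a finite concatenation of
  subsegments of edges, has length \<open>l\<close>.
\<close>

inductive pl_path ::
  "('a, 'b) pre_digraph \<Rightarrow> ('a, 'b) graph_point \<Rightarrow> real \<Rightarrow> ('a, 'b) graph_point \<Rightarrow> bool"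
  for G where
  refl: "x \<in> realization G \<Longrightarrow> pl_path G x 0 x"
| step: "\<lbrakk>e \<in> arcs G; s \<in> {0..1}; t \<in> {0..1}; pl_path G (edge_point G e t) l y\<rbrakk>
    \<Longrightarrow> pl_path G (edge_point G e s) (\<bar>s - t\<bar> + l) y"

text \<open>The length metric; its values are meaningful on \<open>realization G\<close> for connected \<open>G\<close>.\<close>

definition gdist ::
  "('a, 'b) pre_digraph \<Rightarrow> ('a, 'b) graph_point \<Rightarrow> ('a, 'b) graph_point \<Rightarrow> real" where
  "gdist G x y = Inf {l. pl_path G x l y}"

text \<open>
  Geodesics are treated as subsets: \<open>geodesic G x y \<sigma>\<close> says that \<open>\<sigma>\<close> is the image of an isometric
  embedding of a compact interval that joins \<open>x\<close> to \<open>y\<close>.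
\<close>

definition geodesic ::
  "('a, 'b) pre_digraph \<Rightarrow> ('a, 'b) graph_point \<Rightarrow> ('a, 'b) graph_point
    \<Rightarrow> ('a, 'b) graph_point set \<Rightarrow> bool" where
  "geodesic G x y \<sigma> \<longleftrightarrow>
     (\<exists>L \<ge> 0. \<exists>\<gamma>. \<gamma> ` {0..L} \<subseteq> realization G \<and> \<gamma> 0 = x \<and> \<gamma> L = y
        \<and> (\<forall>s \<in> {0..L}. \<forall>t \<in> {0..L}. gdist G (\<gamma> s) (\<gamma> t) = \<bar>s - t\<bar>)
        \<and> \<sigma> = \<gamma> ` {0..L})"

text \<open>Distance to a set; only meaningful for nonempty \<open>S\<close>.\<close>

definition gsetdist ::
  "('a, 'b) pre_digraph \<Rightarrow> ('a, 'b) graph_point \<Rightarrow> ('a, 'b) graph_point set \<Rightarrow> real" where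
  "gsetdist G x S = (INF y \<in> S. gdist G x y)"

definition nbhd ::
  "('a, 'b) pre_digraph \<Rightarrow> real \<Rightarrow> ('a, 'b) graph_point set \<Rightarrow> ('a, 'b) graph_point set" where
  "nbhd G r S = {x \<in> realization G. gsetdist G x S \<le> r}"

text \<open>Real valued, hence only meaningful for nonempty sets at finite distance, such as geodesics.\<close>

definition hausdorff_distance ::
  "('a, 'b) pre_digraph \<Rightarrow> ('a, 'b) graph_point set \<Rightarrow> ('a, 'b) graph_point set \<Rightarrow> real" where
  "hausdorff_distance G A B = Inf {r. 0 \<le> r \<and> A \<subseteq> nbhd G r B \<and> B \<subseteq> nbhd G r A}"

definition vertex_geodesics_stable :: "('a, 'b) pre_digraph \<Rightarrow> bool" where
  "vertex_geodesics_stable G \<longleftrightarrow>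
     (\<exists>R \<ge> 0. \<forall>a \<in> verts G. \<forall>b \<in> verts G. \<forall>\<tau> \<sigma>.
        geodesic G (Vertex a) (Vertex b) \<tau> \<longrightarrow> geodesic G (Vertex a) (Vertex b) \<sigma>
          \<longrightarrow> hausdorff_distance G \<sigma> \<tau> \<le> R)"

definition obstructing :: "('a, 'b) pre_digraph \<Rightarrow> nat \<Rightarrow> 'a \<Rightarrow> 'a \<Rightarrow> 'a set \<Rightarrow> bool" where
  "obstructing G r a b S \<longleftrightarrow>
     (\<forall>\<gamma>. geodesic G (Vertex a) (Vertex b) \<gamma> \<longrightarrow> \<gamma> \<inter> nbhd G (real r) (Vertex ` S) \<noteq> {})"

definition obstructing_vertex :: "('a, 'b) pre_digraph \<Rightarrow> nat \<Rightarrow> 'a \<Rightarrow> 'a \<Rightarrow> 'a \<Rightarrow> bool" where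
  "obstructing_vertex G r a b v \<longleftrightarrow> obstructing G r a b {v}"

end

theory Submission
  imports Defs
begin

text \<open>
  The idea is that a geodesic \<open>\<gamma>\<close> between vertices visits a vertex at every integer time
  (\<open>geodesic_integer_time_vertex\<close>), so obstruction at the vertices of a geodesic controls all of
  its points.

  If stability holds with constant \<open>R\<close> and \<open>k > R\<close> is a natural number, then every vertex of a
  geodesic from \<open>a\<close> to \<open>b\<close> is at distance less than \<open>k\<close> from some point of any other such
  geodesic, so it is obstructing with radius \<open>k\<close>. Conversely, suppose that \<open>k\<close> has the stated property, let
  \<open>\<tau>\<close> and \<open>\<sigma>\<close> be geodesics of length \<open>L\<close> from \<open>a\<close> to \<open>b\<close>, and let \<open>x\<close> be the point of \<open>\<tau>\<close> at
  time \<open>s\<close>. If \<open>s \<le> k + 1\<close> or \<open>L - s \<le> k + 1\<close>, then \<open>x\<close> is within \<open>k + 1\<close> of \<open>a\<close> or \<open>b\<close>, both of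
  which lie on \<open>\<sigma>\<close>. Otherwise \<open>2 * k + 2 < L\<close>, and the vertex \<open>v\<close> visited at time \<open>\<lfloor>s\<rfloor>\<close> is
  farther than \<open>k\<close> from both ends; the geodesic \<open>\<sigma>\<close> meets the \<open>k\<close>-ball about \<open>v\<close>, so \<open>x\<close>
  is within \<open>k + 1\<close> of \<open>\<sigma>\<close> (\<open>obstruction_imp_close\<close>). By symmetry the Hausdorff distance is at
  most \<open>k + 1\<close>.

  That integer times are spent at vertices comes from computing the length metric seen from a vertex
  \<open>b\<close>: distances between vertices are integers \<open>m\<close>, and the point at parameter \<open>t\<close> of an edge
  has distance \<open>m + t\<close> or \<open>n + (1 - t)\<close> with integers \<open>m\<close> and \<open>n\<close>, according to the endpoint through
  which it reaches \<open>b\<close> (\<open>gdist_to_Vertex\<close>). For \<open>0 < t < 1\<close> this is never an integer.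
\<close>

section \<open>The length metric\<close>

lemma pl_path_nonneg: "pl_path G x l y \<Longrightarrow> 0 \<le> l"
  by (induction rule: pl_path.induct) auto

lemma gdist_le: "pl_path G x l y \<Longrightarrow> gdist G x y \<le> l"
  unfolding gdist_def by (rule cInf_lower) (auto intro!: bdd_belowI[of _ 0] pl_path_nonneg)

lemma pl_path_trans:
  assumes "pl_path G x l y" and "pl_path G y m z"
  shows "pl_path G x (l + m) z"
  using assms
proof (induction rule: pl_path.induct)
  case (step e s t l y)
  then have "pl_path G (edge_point G e s) (\<bar>s - t\<bar> + (l + m)) z"
    by (intro pl_path.step) auto
  then show ?case by (simp add: add.assoc)
qed simp

locale connected_graph = wf_digraph G for G :: "('a, 'b) pre_digraph" +
  assumes conn: "Digraph_Component.connected G"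
begin

lemma edge_point_in_realization:
  "e \<in> arcs G \<Longrightarrow> t \<in> {0..1} \<Longrightarrow> edge_point G e t \<in> realization G"
  by (auto simp: edge_point_def realization_def)

lemma realization_cases:
  assumes "x \<in> realization G"
  obtains (Vertex) v where "v \<in> verts G" "x = Vertex v"
    | (Interior) e t where "e \<in> arcs G" "0 < t" "t < 1" "x = Interior e t"
  using assms by (auto simp: realization_def)

lemma pl_path_segment:
  assumes "e \<in> arcs G" "s \<in> {0..1}" "t \<in> {0..1}"
  shows "pl_path G (edge_point G e s) \<bar>s - t\<bar> (edge_point G e t)"
  using pl_path.step[OF assms pl_path.refl[OF edge_point_in_realization[OF assms(1,3)]]] by simp

lemma pl_path_sym: "pl_path G x l y \<Longrightarrow> pl_path G y l x"
proof (induction rule: pl_path.induct)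
  case (refl x)
  then show ?case by (rule pl_path.refl)
next
  case (step e s t l y)
  then show ?case
    using pl_path_trans[OF step.IH pl_path_segment[of e t s]]
    by (simp add: abs_minus_commute add.commute)
qed

lemma pl_path_edge:
  assumes "e \<in> arcs G"
  shows "pl_path G (Vertex (tail G e)) 1 (Vertex (head G e))"
  using pl_path_segment[OF assms, of 0 1] by (simp add: edge_point_def)

lemma ex_pl_path_verts:
  assumes "u \<in> verts G" and "v \<in> verts G"
  shows "\<exists>n. pl_path G (Vertex u) (real n) (Vertex v)"
proof -
  interpret S: pair_wf_digraph "mk_symmetric G" ..
  have "u \<rightarrow>\<^sup>*\<^bsub>with_proj (mk_symmetric G)\<^esub> v"
    using conn assms unfolding Digraph_Component.connected_def by (auto simp: strongly_connected_def)
  then show ?thesis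
  proof (induction rule: S.converse_reachable_induct)
    case base
    have "pl_path G (Vertex v) (real 0) (Vertex v)"
      using assms by (simp add: pl_path.refl realization_def)
    then show ?case by blast
  next
    case (step x y)
    from step.hyps have "pl_path G (Vertex x) 1 (Vertex y)"
      by (auto simp: parcs_mk_symmetric intro: pl_path_edge pl_path_sym)
    moreover obtain n where "pl_path G (Vertex y) (real n) (Vertex v)"
      using step.IH by blast
    ultimately have "pl_path G (Vertex x) (real (Suc n)) (Vertex v)"
      using pl_path_trans by fastforce
    then show ?case by blast
  qed
qed

lemma ex_pl_path:
  assumes "x \<in> realization G" and "y \<in> realization G"
  shows "\<exists>l. pl_path G x l y"
proof -
  have to_vertex: "\<exists>v\<in>verts G. \<exists>l. pl_path G z l (Vertex v)" if "z \<in> realization G" for z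
    using that
  proof (cases rule: realization_cases)
    case (Vertex v)
    then show ?thesis using pl_path.refl[OF that] by blast
  next
    case (Interior e t)
    then have "pl_path G z \<bar>t - 0\<bar> (Vertex (tail G e))"
      using pl_path_segment[of e t 0] by (simp add: edge_point_def)
    with Interior show ?thesis using tail_in_verts by blast
  qed
  obtain u v l m where "u \<in> verts G" "v \<in> verts G"
    and "pl_path G x l (Vertex u)" and "pl_path G y m (Vertex v)"
    using to_vertex[OF assms(1)] to_vertex[OF assms(2)] by blast
  then show ?thesis
    using ex_pl_path_verts[of u v] pl_path_trans pl_path_sym by metis
qed

lemma gdist_nonneg:
  assumes "x \<in> realization G" and "y \<in> realization G"
  shows "0 \<le> gdist G x y"
  unfolding gdist_def using ex_pl_path[OF assms] by (intro cInf_greatest) (auto intro: pl_path_nonneg)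

lemma gdist_commute: "gdist G x y = gdist G y x"
  unfolding gdist_def by (rule arg_cong[where f = Inf]) (auto intro: pl_path_sym)

lemma gdist_triangle:
  assumes "x \<in> realization G" "y \<in> realization G" "z \<in> realization G"
  shows "gdist G x z \<le> gdist G x y + gdist G y z"
proof -
  have "gdist G x z - l \<le> gdist G y z" if l: "pl_path G x l y" for l
    unfolding gdist_def[of G y z]
  proof (rule cInf_greatest)
    show "{m. pl_path G y m z} \<noteq> {}" using ex_pl_path[OF assms(2,3)] by blast
    show "gdist G x z - l \<le> m" if "m \<in> {m. pl_path G y m z}" for m
      using gdist_le[OF pl_path_trans[OF l]] that by fastforce
  qed
  then have "gdist G x z - gdist G y z \<le> gdist G x y"
    unfolding gdist_def[of G x y] using ex_pl_path[OF assms(1,2)]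
    by (intro cInf_greatest) fastforce+
  then show ?thesis by simp
qed

section \<open>Distances from a vertex\<close>

definition edge_dist :: "'a \<Rightarrow> 'a \<Rightarrow> nat" where
  "edge_dist b u = (LEAST n. pl_path G (Vertex u) (real n) (Vertex b))"

fun vertex_dist :: "'a \<Rightarrow> ('a, 'b) graph_point \<Rightarrow> real" where
  "vertex_dist b (Vertex u) = edge_dist b u"
| "vertex_dist b (Interior e t) =
     min (real (edge_dist b (tail G e)) + t) (real (edge_dist b (head G e)) + (1 - t))"

lemma pl_path_edge_dist:
  assumes "b \<in> verts G" and "u \<in> verts G"
  shows "pl_path G (Vertex u) (real (edge_dist b u)) (Vertex b)"
  unfolding edge_dist_def using ex_pl_path_verts[OF assms(2,1)] by (rule LeastI_ex)

lemma edge_dist_le: "pl_path G (Vertex u) (real n) (Vertex b) \<Longrightarrow> edge_dist b u \<le> n"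
  unfolding edge_dist_def by (rule Least_le)

lemma edge_dist_adjacent:
  assumes "b \<in> verts G" and e: "e \<in> arcs G"
  shows "edge_dist b (tail G e) \<le> Suc (edge_dist b (head G e))"
    and "edge_dist b (head G e) \<le> Suc (edge_dist b (tail G e))"
  using pl_path_trans[OF pl_path_edge[OF e] pl_path_edge_dist[of b "head G e"]]
    pl_path_trans[OF pl_path_sym[OF pl_path_edge[OF e]] pl_path_edge_dist[of b "tail G e"]] assms
  by (auto intro!: edge_dist_le)

text \<open>
  The endpoints of an edge differ by at most one in \<open>edge_dist\<close>, so the formula for interior points
  extends to them.
\<close>

lemma vertex_dist_edge_point:
  assumes "b \<in> verts G" "e \<in> arcs G" "t \<in> {0..1}"
  shows "vertex_dist b (edge_point G e t) =
    min (real (edge_dist b (tail G e)) + t) (real (edge_dist b (head G e)) + (1 - t))"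
  using edge_dist_adjacent[OF assms(1,2)] assms(3) by (auto simp: edge_point_def min_def)

text \<open>
  Along each edge \<open>vertex_dist b\<close> is a minimum of functions of slope \<open>1\<close> and \<open>-1\<close>, hence it drops
  along a piecewise linear path by at most the length.
\<close>

lemma vertex_dist_le_pl_path:
  assumes "pl_path G x l y" and "y = Vertex b" and "b \<in> verts G"
  shows "vertex_dist b x \<le> l"
  using assms
proof (induction rule: pl_path.induct)
  case (refl x)
  then have "pl_path G (Vertex b) (real 0) (Vertex b)" by (simp add: pl_path.refl)
  with refl show ?case using edge_dist_le[of b 0 b] by simp
next
  case (step e s t l y)
  then have "vertex_dist b (edge_point G e t) \<le> l" by simp
  then show ?case
    unfolding vertex_dist_edge_point[OF \<open>b \<in> verts G\<close> step.hyps(1,2)]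
      vertex_dist_edge_point[OF \<open>b \<in> verts G\<close> step.hyps(1,3)]
    by linarith
qed

lemma pl_path_vertex_dist:
  assumes "b \<in> verts G" and "x \<in> realization G"
  shows "pl_path G x (vertex_dist b x) (Vertex b)"
  using assms(2)
proof (cases rule: realization_cases)
  case (Vertex v)
  then show ?thesis using pl_path_edge_dist[OF assms(1)] by simp
next
  case (Interior e t)
  have "pl_path G x t (Vertex (tail G e))" "pl_path G x (1 - t) (Vertex (head G e))"
    using Interior pl_path_segment[of e t 0] pl_path_segment[of e t 1]
    by (simp_all add: edge_point_def)
  from this[THEN pl_path_trans, OF pl_path_edge_dist[OF assms(1)]]
  show ?thesis using Interior by (auto simp: min_def add.commute)
qed

lemma gdist_to_Vertex:
  assumes "b \<in> verts G" and "x \<in> realization G"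
  shows "gdist G x (Vertex b) = vertex_dist b x"
  using pl_path_vertex_dist[OF assms] vertex_dist_le_pl_path assms(1) unfolding gdist_def
  by (intro cInf_eq_minimum) auto

text \<open>Modulo \<open>1\<close>, \<open>vertex_dist b (Interior e t)\<close> is \<open>t\<close> or \<open>-t\<close>, and \<open>0 < t < 1\<close>.\<close>

lemma integer_gdist_imp_Vertex:
  assumes "b \<in> verts G" and "x \<in> realization G" and "gdist G x (Vertex b) \<in> \<int>"
  shows "\<exists>v\<in>verts G. x = Vertex v"
  using assms(2)
proof (cases rule: realization_cases)
  case (Interior e t)
  have "real m + t \<notin> \<int>" "real m + (1 - t) \<notin> \<int>" for m
  proof -
    have "t \<notin> \<int>"
      using Interior(2,3) by (auto elim!: Ints_cases)
    then show "real m + t \<notin> \<int>" "real m + (1 - t) \<notin> \<int>"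
      using Ints_diff[of "real m + t" "real m"] Ints_diff[of "real m + 1" "real m + (1 - t)"] by auto
  qed
  moreover have "vertex_dist b x \<in> \<int>" using assms by (simp add: gdist_to_Vertex)
  ultimately show ?thesis using Interior by (simp add: min_def split: if_splits)
qed blast

section \<open>Geodesics between vertices\<close>

lemma geodesicE:
  assumes "geodesic G x y \<sigma>"
  obtains \<gamma> where "\<sigma> = \<gamma> ` {0..gdist G x y}" "\<gamma> 0 = x" "\<gamma> (gdist G x y) = y"
    "\<sigma> \<subseteq> realization G" "0 \<le> gdist G x y"
    "\<And>s t. s \<in> {0..gdist G x y} \<Longrightarrow> t \<in> {0..gdist G x y} \<Longrightarrow> gdist G (\<gamma> s) (\<gamma> t) = \<bar>s - t\<bar>"
proof -
  obtain L \<gamma> where L: "0 \<le> L" "\<gamma> ` {0..L} \<subseteq> realization G" "\<gamma> 0 = x" "\<gamma> L = y"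
    and iso: "\<And>s t. s \<in> {0..L} \<Longrightarrow> t \<in> {0..L} \<Longrightarrow> gdist G (\<gamma> s) (\<gamma> t) = \<bar>s - t\<bar>"
    and "\<sigma> = \<gamma> ` {0..L}"
    using assms unfolding geodesic_def by blast
  moreover have "gdist G x y = L" using iso[of 0 L] L by simp
  ultimately show ?thesis using that[of \<gamma>] by simp
qed

lemma geodesic_endpoints:
  assumes "geodesic G x y \<sigma>"
  shows "x \<in> \<sigma>" and "y \<in> \<sigma>"
proof -
  obtain \<gamma> where "\<sigma> = \<gamma> ` {0..gdist G x y}" "\<gamma> 0 = x" "\<gamma> (gdist G x y) = y" "0 \<le> gdist G x y"
    using assms by (rule geodesicE)
  then show "x \<in> \<sigma>" "y \<in> \<sigma>"
    using imageI[of 0 _ \<gamma>] imageI[of "gdist G x y" _ \<gamma>] by auto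
qed

lemma geodesic_subset: "geodesic G x y \<sigma> \<Longrightarrow> \<sigma> \<subseteq> realization G"
  by (auto elim!: geodesicE)

lemma geodesic_integer_time_vertex:
  assumes "a \<in> verts G" and "n \<in> \<int>" and "0 \<le> n" and "\<gamma> n \<in> realization G"
    and "\<gamma> 0 = Vertex a" and "gdist G (\<gamma> n) (\<gamma> 0) = \<bar>n - 0\<bar>"
  shows "\<exists>v\<in>verts G. \<gamma> n = Vertex v"
  using integer_gdist_imp_Vertex[OF assms(1,4)] assms by simp

section \<open>Distances to sets\<close>

lemma gsetdist_le:
  assumes "x \<in> realization G" "S \<subseteq> realization G" "y \<in> S"
  shows "gsetdist G x S \<le> gdist G x y"
  unfolding gsetdist_def using assms gdist_nonneg
  by (intro cINF_lower bdd_belowI2[where m = 0]) auto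

lemma gsetdist_lessD:
  assumes "S \<noteq> {}" and "gsetdist G x S < r"
  shows "\<exists>y\<in>S. gdist G x y < r"
proof (rule ccontr)
  assume "\<not> ?thesis"
  then have "r \<le> gsetdist G x S"
    unfolding gsetdist_def using assms(1) by (intro cINF_greatest) auto
  with assms(2) show False by simp
qed

lemma nbhd_Vertex:
  "nbhd G r (Vertex ` {v}) = {x \<in> realization G. gdist G x (Vertex v) \<le> r}"
  by (simp add: nbhd_def gsetdist_def)

lemma nbhdI:
  assumes "x \<in> realization G" "S \<subseteq> realization G" "y \<in> S" "gdist G x y \<le> r"
  shows "x \<in> nbhd G r S"
  using assms gsetdist_le[of x S y] by (auto simp: nbhd_def)

lemma hausdorff_distance_le:
  assumes "0 \<le> r" "A \<subseteq> nbhd G r B" "B \<subseteq> nbhd G r A"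
  shows "hausdorff_distance G A B \<le> r"
  unfolding hausdorff_distance_def using assms by (intro cInf_lower bdd_belowI[where m = 0]) auto

text \<open>
  The ends are common to both geodesics, so each is contained in a neighbourhood of the other whose
  radius is the length: the infimum in the Hausdorff distance is over a nonempty set. It need not be
  attained, whence the strict bounds.
\<close>

lemma geodesics_hausdorff_lessD:
  assumes \<sigma>: "geodesic G x y \<sigma>" and \<tau>: "geodesic G x y \<tau>"
    and less: "hausdorff_distance G \<sigma> \<tau> < r" and z: "z \<in> \<tau>"
  shows "\<exists>w\<in>\<sigma>. gdist G z w < r"
proof -
  have close: "A \<subseteq> nbhd G (gdist G x y) B" if A: "geodesic G x y A" and B: "geodesic G x y B" for A B
  proof
    fix p assume "p \<in> A"
    moreover from A obtain \<gamma> where \<gamma>: "A = \<gamma> ` {0..gdist G x y}" "\<gamma> 0 = x" "0 \<le> gdist G x y"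
      "\<And>s t. s \<in> {0..gdist G x y} \<Longrightarrow> t \<in> {0..gdist G x y} \<Longrightarrow> gdist G (\<gamma> s) (\<gamma> t) = \<bar>s - t\<bar>"
      by (rule geodesicE) blast
    ultimately obtain s where s: "s \<in> {0..gdist G x y}" "p = \<gamma> s" by blast
    with \<gamma>(2,3) \<gamma>(4)[of s 0] have "gdist G p x \<le> gdist G x y" by simp
    then show "p \<in> nbhd G (gdist G x y) B"
      using geodesic_subset[OF A] geodesic_subset[OF B] geodesic_endpoints(1)[OF B] \<open>p \<in> A\<close>
      by (intro nbhdI[where y = x]) auto
  qed
  let ?radii = "{r. 0 \<le> r \<and> \<sigma> \<subseteq> nbhd G r \<tau> \<and> \<tau> \<subseteq> nbhd G r \<sigma>}"
  have "0 \<le> gdist G x y" using \<sigma> by (rule geodesicE)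
  with close[OF \<sigma> \<tau>] close[OF \<tau> \<sigma>] have "?radii \<noteq> {}" by blast
  with less obtain q where "q < r" "\<tau> \<subseteq> nbhd G q \<sigma>"
    unfolding hausdorff_distance_def by (metis (no_types, lifting) cInf_lessD mem_Collect_eq)
  with z have "gsetdist G z \<sigma> < r" by (auto simp: nbhd_def)
  then show ?thesis using geodesic_endpoints(1)[OF \<sigma>] by (intro gsetdist_lessD) auto
qed

section \<open>Stability and obstruction\<close>

lemma hausdorff_less_imp_obstructing:
  assumes v: "v \<in> verts G" "Vertex v \<in> \<tau>" and \<tau>: "geodesic G (Vertex a) (Vertex b) \<tau>"
    and less: "\<And>\<sigma>. geodesic G (Vertex a) (Vertex b) \<sigma> \<Longrightarrow> hausdorff_distance G \<sigma> \<tau> < real k"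
  shows "obstructing_vertex G k a b v"
  unfolding obstructing_vertex_def obstructing_def
proof (intro allI impI)
  fix \<sigma> assume \<sigma>: "geodesic G (Vertex a) (Vertex b) \<sigma>"
  obtain y where "y \<in> \<sigma>" "gdist G (Vertex v) y < real k"
    using geodesics_hausdorff_lessD[OF \<sigma> \<tau> less[OF \<sigma>] v(2)] by blast
  then have "y \<in> nbhd G (real k) (Vertex ` {v})"
    using geodesic_subset[OF \<sigma>] unfolding nbhd_Vertex gdist_commute[of "Vertex v"] by auto
  with \<open>y \<in> \<sigma>\<close> show "\<sigma> \<inter> nbhd G (real k) (Vertex ` {v}) \<noteq> {}" by blast
qed

lemma obstruction_imp_close:
  fixes k :: nat
  assumes a: "a \<in> verts G" and b: "b \<in> verts G"
    and \<tau>: "geodesic G (Vertex a) (Vertex b) \<tau>" and \<sigma>: "geodesic G (Vertex a) (Vertex b) \<sigma>"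
    and obstr: "\<And>v. gdist G (Vertex a) (Vertex b) \<ge> 2 * real k + 2 \<Longrightarrow> v \<in> verts G \<Longrightarrow>
      Vertex v \<in> \<tau> \<Longrightarrow> gsetdist G (Vertex v) {Vertex a, Vertex b} > real k \<Longrightarrow>
      obstructing_vertex G k a b v"
  shows "\<tau> \<subseteq> nbhd G (real k + 1) \<sigma>"
proof
  fix x assume x: "x \<in> \<tau>"
  define L where "L = gdist G (Vertex a) (Vertex b)"
  obtain \<gamma> where im: "\<tau> = \<gamma> ` {0..L}" and ends: "\<gamma> 0 = Vertex a" "\<gamma> L = Vertex b"
    and "0 \<le> L"
    and iso: "\<And>s t. s \<in> {0..L} \<Longrightarrow> t \<in> {0..L} \<Longrightarrow> gdist G (\<gamma> s) (\<gamma> t) = \<bar>s - t\<bar>"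
    using \<tau> unfolding L_def by (rule geodesicE) blast
  obtain s where s: "0 \<le> s" "s \<le> L" "x = \<gamma> s" using x im by auto
  have sub: "\<tau> \<subseteq> realization G" "\<sigma> \<subseteq> realization G"
    using geodesic_subset \<tau> \<sigma> by blast+
  have "\<exists>y\<in>\<sigma>. gdist G x y \<le> real k + 1"
  proof -
    consider "s \<le> real k + 1" | "L - s \<le> real k + 1"
      | "real k + 1 < s" "real k + 1 < L - s" by linarith
    then show ?thesis
    proof cases
      case 1
      then have "gdist G x (Vertex a) \<le> real k + 1" using iso[of s 0] s ends \<open>0 \<le> L\<close> by simp
      then show ?thesis using geodesic_endpoints[OF \<sigma>] by blast
    next
      case 2
      then have "gdist G x (Vertex b) \<le> real k + 1" using iso[of s L] s ends \<open>0 \<le> L\<close> by simp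
      then show ?thesis using geodesic_endpoints[OF \<sigma>] by blast
    next
      case 3
      define n where "n = real_of_int \<lfloor>s\<rfloor>"
      have n: "n \<le> s" "s < n + 1" unfolding n_def by linarith+
      with s 3 have n0L: "n \<in> {0..L}" by auto
      then have "\<gamma> n \<in> realization G" using im sub by blast
      then obtain v where v: "v \<in> verts G" "\<gamma> n = Vertex v"
        using geodesic_integer_time_vertex[OF a, of n \<gamma>] iso[of n 0] n0L ends \<open>0 \<le> L\<close>
        by (auto simp: n_def)
      have "gdist G (Vertex v) (Vertex a) = n" "gdist G (Vertex v) (Vertex b) = L - n"
        using iso[of n 0] iso[of n L] n0L ends v by auto
      then have "gsetdist G (Vertex v) {Vertex a, Vertex b} = min n (L - n)"
        unfolding gsetdist_def by (simp add: cInf_eq_Min)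
      then have "gsetdist G (Vertex v) {Vertex a, Vertex b} > real k"
        using n 3 by simp
      moreover have "2 * real k + 2 \<le> L" using 3 by linarith
      moreover have "Vertex v \<in> \<tau>" using v n0L im by (metis imageI)
      ultimately have "obstructing_vertex G k a b v" using obstr v unfolding L_def by blast
      then obtain y where y: "y \<in> \<sigma>" "gdist G y (Vertex v) \<le> real k"
        using \<sigma> unfolding obstructing_vertex_def obstructing_def nbhd_Vertex by blast
      have "gdist G x (Vertex v) \<le> 1" using iso[of s n] n n0L s v by simp
      moreover have "gdist G x y \<le> gdist G x (Vertex v) + gdist G (Vertex v) y"
        using x y \<open>Vertex v \<in> \<tau>\<close> sub by (intro gdist_triangle) auto
      ultimately show ?thesis using y by (intro bexI[of _ y]) (auto simp: gdist_commute)
    qed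
  qed
  then show "x \<in> nbhd G (real k + 1) \<sigma>" using x sub by (auto intro: nbhdI)
qed

end

theorem proposition6p5:
  fixes G :: "('a, 'b) pre_digraph"
  assumes "wf_digraph G" and "Digraph_Component.connected G"
  shows "vertex_geodesics_stable G \<longleftrightarrow>
    (\<exists>k::nat. \<forall>a \<in> verts G. \<forall>b \<in> verts G.
       gdist G (Vertex a) (Vertex b) \<ge> 2 * real k + 2 \<longrightarrow>
       (\<forall>\<tau>. geodesic G (Vertex a) (Vertex b) \<tau> \<longrightarrow>
         (\<forall>v \<in> verts G. Vertex v \<in> \<tau> \<and> gsetdist G (Vertex v) {Vertex a, Vertex b} > real k \<longrightarrow>
            obstructing_vertex G k a b v)))"
    (is "_ \<longleftrightarrow> (\<exists>k. ?obstr k)")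
proof -
  interpret connected_graph G
    using assms by (intro connected_graph.intro connected_graph_axioms.intro)
  show ?thesis
  proof
    assume "vertex_geodesics_stable G"
    then obtain R where R: "\<And>a b \<tau> \<sigma>. \<lbrakk>a \<in> verts G; b \<in> verts G;
        geodesic G (Vertex a) (Vertex b) \<tau>; geodesic G (Vertex a) (Vertex b) \<sigma>\<rbrakk>
        \<Longrightarrow> hausdorff_distance G \<sigma> \<tau> \<le> R"
      unfolding vertex_geodesics_stable_def by blast
    obtain k :: nat where "R < real k" using reals_Archimedean2 by blast
    with R have "hausdorff_distance G \<sigma> \<tau> < real k"
      if "a \<in> verts G" "b \<in> verts G"
        "geodesic G (Vertex a) (Vertex b) \<tau>" "geodesic G (Vertex a) (Vertex b) \<sigma>" for a b \<tau> \<sigma>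
      using that by (meson le_less_trans)
    then have "?obstr k" using hausdorff_less_imp_obstructing by blast
    then show "\<exists>k. ?obstr k" ..
  next
    assume "\<exists>k. ?obstr k"
    then obtain k where k: "?obstr k" ..
    have "\<tau> \<subseteq> nbhd G (real k + 1) \<sigma>"
      if "a \<in> verts G" "b \<in> verts G"
        "geodesic G (Vertex a) (Vertex b) \<tau>" "geodesic G (Vertex a) (Vertex b) \<sigma>" for a b \<tau> \<sigma>
      using that k by (intro obstruction_imp_close[OF that]) blast
    then have "\<forall>a\<in>verts G. \<forall>b\<in>verts G. \<forall>\<tau> \<sigma>. geodesic G (Vertex a) (Vertex b) \<tau> \<longrightarrow>
        geodesic G (Vertex a) (Vertex b) \<sigma> \<longrightarrow> hausdorff_distance G \<sigma> \<tau> \<le> real k + 1"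
      by (intro ballI allI impI hausdorff_distance_le) auto
    then show "vertex_geodesics_stable G"
      unfolding vertex_geodesics_stable_def by (intro exI[of _ "real k + 1"]) auto
  qed
qed

end
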